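(* For every integer $n \ge 1$, the independence complex $I(\Delta^1_{2n})$ is homotopy equivalent to the sphere $S^{n-1}$, and the independence complex $I(\Delta^1_{2n-1})$ is contractible.
   Context: For positive integers $m,n$, the graph $\Delta^m_n$ is the simple graph with vertex set $\{e_i : 1\le i\le n\}\cup\{f^k_i : 1\le i\le n-1,\ 1\le k\le m\}$ and edges exactly: $f^k_i \sim f^k_{i+1}$ for $1\le i\le n-2$ and each $k$, and $e_i\sim f^k_i$, $f^k_i\sim e_{i+1}$ for $1\le i\le n-1$ and each $k$. For a simple graph $G$, the independence complex $I(G)$ is the simplicial complex whose simplices are the independent sets of vertices of $G$. *)

theory Defs
  imports "HOL-Analysis.Analysis"
begin

text \<open>A simple graph is given by its vertex set \<open>V\<close> and its set \<open>D\<close> of two-element edges.\<close>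

definition simple_graph :: "'a set \<Rightarrow> 'a set set \<Rightarrow> bool" where
  "simple_graph V D \<longleftrightarrow> (\<forall>d\<in>D. d \<subseteq> V \<and> card d = 2)"

text \<open>The empty simplex belongs to the complex; it contributes no point to the
  geometric realization below.\<close>

definition independence_complex :: "'a set \<Rightarrow> 'a set set \<Rightarrow> 'a set set" where
  "independence_complex V D =
     {S. finite S \<and> S \<subseteq> V \<and> (\<forall>u\<in>S. \<forall>v\<in>S. {u, v} \<notin> D)}"

text \<open>Points are given by their barycentric coordinates, with the topology of pointwise
  convergence. For complexes with finitely many vertices, the only ones considered here, this
  is the usual topology of the polyhedron.\<close>

definition geometric_realization :: "'a set set \<Rightarrow> ('a \<Rightarrow> real) topology" where
  "geometric_realization K =
     subtopology (powertop_real UNIV)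
       {x. (\<forall>v. 0 \<le> x v) \<and> {v. x v \<noteq> 0} \<in> K \<and> (\<Sum>v | x v \<noteq> 0. x v) = 1}"

text \<open>\<open>Ev i\<close> is $e_i$ and \<open>Fv k i\<close> is $f^k_i$. The indices below start at 1, so the
  truncated subtractions \<open>n - 1\<close> and \<open>n - 2\<close> give empty ranges whenever they should.\<close>

datatype Delta_vertex = Ev nat | Fv nat nat

definition Delta_verts :: "nat \<Rightarrow> nat \<Rightarrow> Delta_vertex set" where
  "Delta_verts m n =
     {Ev i | i. 1 \<le> i \<and> i \<le> n} \<union>
     {Fv k i | k i. 1 \<le> i \<and> i \<le> n - 1 \<and> 1 \<le> k \<and> k \<le> m}"

definition Delta_edges :: "nat \<Rightarrow> nat \<Rightarrow> Delta_vertex set set" where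
  "Delta_edges m n =
     {{Fv k i, Fv k (i + 1)} | k i. 1 \<le> i \<and> i \<le> n - 2 \<and> 1 \<le> k \<and> k \<le> m} \<union>
     {{Ev i, Fv k i} | k i. 1 \<le> i \<and> i \<le> n - 1 \<and> 1 \<le> k \<and> k \<le> m} \<union>
     {{Fv k i, Ev (i + 1)} | k i. 1 \<le> i \<and> i \<le> n - 1 \<and> 1 \<le> k \<and> k \<le> m}"

lemma finite_Delta_verts: "finite (Delta_verts m n)"
proof (rule finite_subset)
  show "Delta_verts m n \<subseteq> Ev ` {..n} \<union> (\<lambda>(k, i). Fv k i) ` ({..m} \<times> {..n})"
    by (force simp: Delta_verts_def)
qed simp

lemma simple_graph_Delta: "simple_graph (Delta_verts m n) (Delta_edges m n)"
  by (auto simp: simple_graph_def Delta_verts_def Delta_edges_def)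

definition I_Delta :: "nat \<Rightarrow> nat \<Rightarrow> (Delta_vertex \<Rightarrow> real) topology" where
  "I_Delta m n =
     geometric_realization (independence_complex (Delta_verts m n) (Delta_edges m n))"

end

theory Submission
  imports Defs
begin

text \<open>Moving the barycentric weight of a vertex \<open>v\<close> onto a vertex \<open>u\<close> whose neighbours are all
  neighbours of \<open>v\<close> is a deformation retraction of the independence complex onto the part that
  avoids \<open>v\<close>. Since $f_1$ is the only neighbour of $e_1$, both $e_2$ and $f_2$ can be
  removed in this way; after that $f_3$ is the only neighbour of $e_3$, so $e_4$ and $f_4$ can be
  removed, and so on. What remains is the graph on the vertices of odd index, whose edges
  $e_i \sim f_i$ are pairwise disjoint. For $\Delta^1_{2n}$ its complex is the boundary of
  the $n$-dimensional cross-polytope, which is radially homeomorphic to $S^{n-1}$; for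
  $\Delta^1_{2n-1}$ the vertex $e_{2n-1}$ is isolated and the complex is a cone.\<close>

section \<open>Homotopies between maps into a polyhedron\<close>

text \<open>A sum over the fixed set \<open>V\<close> is linear in \<open>x\<close>, whereas a sum
  over the support ranges over a set that changes with \<open>x\<close>; convex combinations are
  handled with the former.\<close>

lemma geometric_realization_finite:
  assumes "finite V" "\<Union>K \<subseteq> V"
  shows "geometric_realization K = subtopology (powertop_real UNIV)
           {x. (\<forall>v. 0 \<le> x v) \<and> {v. x v \<noteq> 0} \<in> K \<and> sum x V = 1}"
proof -
  have "(\<Sum>v | x v \<noteq> 0. x v) = sum x V" if "{v. x v \<noteq> 0} \<in> K" for x :: "'a \<Rightarrow> real"
    using assms that by (intro sum.mono_neutral_left) auto
  then show ?thesis
    unfolding geometric_realization_def by (metis (mono_tags, lifting))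
qed

lemma continuous_map_geometric_realization_coord:
  "continuous_map (geometric_realization K) euclideanreal (\<lambda>x. x v)"
  unfolding geometric_realization_def
  by (intro continuous_map_from_subtopology continuous_map_product_coordinates) simp

text \<open>The straight-line homotopy works: by \<open>fg\<close> the points \<open>f x\<close> and
  \<open>g x\<close> lie in a common simplex, which contains the segment between them.\<close>

lemma homotopic_into_geometric_realization:
  assumes V: "finite V" "\<Union>K \<subseteq> V" and down: "\<And>S T. S \<in> K \<Longrightarrow> T \<subseteq> S \<Longrightarrow> T \<in> K"
    and f: "continuous_map X (geometric_realization K) f"
    and g: "continuous_map X (geometric_realization K) g"
    and fg: "\<And>x. x \<in> topspace X \<Longrightarrow> {v. f x v \<noteq> 0} \<union> {v. g x v \<noteq> 0} \<in> K"
  shows "homotopic_with (\<lambda>_. True) X (geometric_realization K) f g"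
proof -
  let ?h = "\<lambda>(t, x) v. (1 - t) * f x v + t * g x v"
  note real = geometric_realization_finite[OF V]
  have coord: "continuous_map (prod_topology (top_of_set {0..1}) X) euclideanreal (\<lambda>z. k (snd z) v)"
    if "continuous_map X (geometric_realization K) k" for k v
    using continuous_map_compose[OF continuous_map_snd
        continuous_map_compose[OF that continuous_map_geometric_realization_coord[of K v]]]
    by (simp add: o_def)
  have fst: "continuous_map (prod_topology (top_of_set {0..1::real}) X) euclideanreal fst"
    using continuous_map_fst continuous_map_into_fulltopology by blast
  have "?h (t, x) \<in> {x. (\<forall>v. 0 \<le> x v) \<and> {v. x v \<noteq> 0} \<in> K \<and> sum x V = 1}"
    if t: "t \<in> {0..1}" and x: "x \<in> topspace X" for t x
  proof -
    have "f x \<in> topspace (geometric_realization K)" "g x \<in> topspace (geometric_realization K)"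
      using f g x by (auto simp: continuous_map_def)
    then have fx: "\<And>v. 0 \<le> f x v" "sum (f x) V = 1" and gx: "\<And>v. 0 \<le> g x v" "sum (g x) V = 1"
      by (auto simp: real)
    have "{v. (1 - t) * f x v + t * g x v \<noteq> 0} \<subseteq> {v. f x v \<noteq> 0} \<union> {v. g x v \<noteq> 0}"
      by auto
    with fg[OF x] down have "{v. (1 - t) * f x v + t * g x v \<noteq> 0} \<in> K"
      by blast
    moreover have "(\<Sum>v\<in>V. (1 - t) * f x v + t * g x v) = 1"
      by (simp add: sum.distrib fx gx flip: sum_distrib_left)
    ultimately show ?thesis
      using t fx gx by auto
  qed
  moreover have "continuous_map (prod_topology (top_of_set {0..1}) X) (powertop_real UNIV) ?h"
    unfolding continuous_map_componentwise_UNIV case_prod_unfold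
    by (intro allI continuous_intros coord f g fst)
  ultimately have "continuous_map (prod_topology (top_of_set {0..1}) X) (geometric_realization K) ?h"
    unfolding real by (intro continuous_map_into_subtopology) auto
  then show ?thesis
    unfolding homotopic_with_def by (intro exI[of _ ?h]) auto
qed

text \<open>Formulated for a complex rather than a graph, so that it applies again to what an
  earlier removal has left. With \<open>down\<close>, the condition \<open>dom\<close> makes the
  link of \<open>v\<close> a cone with apex \<open>u\<close>. The supports of \<open>x\<close> and
  \<open>r x\<close> both lie in one simplex, so \<open>r\<close> is homotopic to the identity along
  segments.\<close>

lemma fold_homotopy_equivalent_space:
  assumes V: "finite V" "\<Union>K \<subseteq> V" and down: "\<And>S T. S \<in> K \<Longrightarrow> T \<subseteq> S \<Longrightarrow> T \<in> K"
    and "u \<noteq> v" and dom: "\<And>S. S \<in> K \<Longrightarrow> v \<in> S \<Longrightarrow> insert u S \<in> K"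
  shows "geometric_realization K homotopy_equivalent_space
         geometric_realization {S \<in> K. v \<notin> S}"
proof -
  let ?L = "{S \<in> K. v \<notin> S}"
  define r :: "('a \<Rightarrow> real) \<Rightarrow> 'a \<Rightarrow> real" where "r x = x(u := x u + x v, v := 0)" for x
  have VL: "\<Union>?L \<subseteq> V" using V by auto
  note real = geometric_realization_finite[OF V] geometric_realization_finite[OF V(1) VL]
  have supp: "{w. r x w \<noteq> 0} \<union> {w. x w \<noteq> 0} \<in> K" and r_in: "{w. r x w \<noteq> 0} \<in> ?L"
    and r_nonneg: "0 \<le> r x w" and r_sum: "sum (r x) V = 1"
    if "x \<in> topspace (geometric_realization K)" for x w
  proof -
    from that have x: "\<And>v. 0 \<le> x v" "{v. x v \<noteq> 0} \<in> K" "sum x V = 1"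
      by (auto simp: real)
    show supp: "{w. r x w \<noteq> 0} \<union> {w. x w \<noteq> 0} \<in> K"
    proof (cases "x v = 0")
      case True
      then have "{w. r x w \<noteq> 0} \<union> {w. x w \<noteq> 0} = {w. x w \<noteq> 0}"
        by (auto simp: r_def)
      with x show ?thesis by simp
    next
      case False
      then have "insert u {w. x w \<noteq> 0} \<in> K"
        using dom x by auto
      moreover have "{w. r x w \<noteq> 0} \<union> {w. x w \<noteq> 0} \<subseteq> insert u {w. x w \<noteq> 0}"
        by (auto simp: r_def)
      ultimately show ?thesis
        using down by blast
    qed
    then have "{w. r x w \<noteq> 0} \<in> K"
      using down by blast
    then show "{w. r x w \<noteq> 0} \<in> ?L"
      by (auto simp: r_def)
    show "0 \<le> r x w"
      using x by (auto simp: r_def)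
    have out: "x w = 0" if "w \<notin> V" for w
      using x V that by auto
    \<comment> \<open>If \<open>v\<close> carries weight, \<open>dom\<close> puts \<open>u\<close>
      into a simplex and hence into \<open>V\<close>, and the weight only moves inside
      \<open>V\<close>. Otherwise \<open>r x = x\<close>, wherever \<open>u\<close> lies.\<close>
    have "sum (r x) V = sum x V"
    proof (cases "v \<in> V")
      case True
      have "u \<in> V" if "x v \<noteq> 0"
        using dom[OF x(2)] that V by auto
      then show ?thesis
      proof (cases "x v = 0")
        case True
        then have "r x = x" by (auto simp: r_def)
        then show ?thesis by simp
      next
        case False
        then have "u \<in> V - {v}" using \<open>x v \<noteq> 0 \<Longrightarrow> u \<in> V\<close> \<open>u \<noteq> v\<close> by auto
        have "sum y V = y v + (y u + sum y (V - {v} - {u}))" for y :: "'a \<Rightarrow> real"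
          using V \<open>v \<in> V\<close> \<open>u \<in> V - {v}\<close> by (simp add: sum.remove)
        note eq = this
        have "sum (r x) (V - {v} - {u}) = sum x (V - {v} - {u})"
          by (intro sum.cong) (auto simp: r_def)
        then show ?thesis
          using eq[of "r x"] eq[of x] \<open>u \<noteq> v\<close> by (simp add: r_def)
      qed
    next
      case False
      then have "r x = x" using out by (auto simp: r_def)
      then show ?thesis by simp
    qed
    then show "sum (r x) V = 1" using x by simp
  qed
  have "continuous_map (geometric_realization K) (powertop_real UNIV) r"
    unfolding continuous_map_componentwise_UNIV r_def fun_upd_apply
  proof
    fix k
    show "continuous_map (geometric_realization K) euclideanreal
            (\<lambda>x. if k = v then 0 else if k = u then x u + x v else x k)"
      by (cases "k = v"; cases "k = u";
          simp add: continuous_map_add continuous_map_geometric_realization_coord)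
  qed
  then have r: "continuous_map (geometric_realization K) (geometric_realization ?L) r"
    unfolding real(2) using r_in r_nonneg r_sum by (intro continuous_map_into_subtopology) auto
  \<comment> \<open>As a subspace cut out by \<open>x v = 0\<close>, the smaller realization is
    included by \<open>id\<close>, and \<open>r\<close> fixes each of its points.\<close>
  have sub: "geometric_realization ?L = subtopology (geometric_realization K) {x. x v = 0}"
    unfolding real subtopology_subtopology by (rule arg_cong[where f = "subtopology _"]) auto
  have id: "continuous_map (geometric_realization ?L) (geometric_realization K) id"
    unfolding sub by simp
  have rK: "continuous_map (geometric_realization K) (geometric_realization K) r"
    using continuous_map_compose[OF r id] by simp
  have "homotopic_with (\<lambda>_. True) (geometric_realization K) (geometric_realization K) r id"
    using supp by (intro homotopic_into_geometric_realization[OF V _ rK continuous_map_id]) (auto intro: down)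
  moreover have "homotopic_with (\<lambda>_. True) (geometric_realization ?L) (geometric_realization ?L) r id"
  proof (rule homotopic_with_equal)
    show "continuous_map (geometric_realization ?L) (geometric_realization ?L) r"
      using continuous_map_compose[OF id r] by simp
    show "r x = id x" if "x \<in> topspace (geometric_realization ?L)" for x
      using that by (auto simp: sub r_def)
  qed auto
  ultimately show ?thesis
    unfolding homotopy_equivalent_space_def using r id by (intro exI[of _ r] exI[of _ id]) simp
qed

text \<open>Everything is contracted along segments to the apex, whose barycentric coordinates are
  \<open>?a\<close>; that \<open>u\<close> is a vertex at all comes from applying
  \<open>cone\<close> to the empty simplex.\<close>

lemma contractible_space_cone:
  assumes V: "finite V" "\<Union>K \<subseteq> V" and down: "\<And>S T. S \<in> K \<Longrightarrow> T \<subseteq> S \<Longrightarrow> T \<in> K"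
    and "{} \<in> K" and cone: "\<And>S. S \<in> K \<Longrightarrow> insert u S \<in> K"
  shows "contractible_space (geometric_realization K)"
proof -
  let ?a = "\<lambda>w. if w = u then 1 else (0 :: real)"
  have supp: "{w. ?a w \<noteq> 0} = {u}"
    by auto
  have u: "{u} \<in> K" using cone[OF \<open>{} \<in> K\<close>] .
  have "?a \<in> topspace (geometric_realization K)"
    using u by (auto simp: geometric_realization_def supp)
  then have "homotopic_with (\<lambda>_. True) (geometric_realization K) (geometric_realization K) id (\<lambda>x. ?a)"
  proof (intro homotopic_into_geometric_realization[OF V] continuous_map_id)
    fix x assume "x \<in> topspace (geometric_realization K)"
    then have "insert u {w. x w \<noteq> 0} \<in> K"
      using cone by (auto simp: geometric_realization_def)
    moreover have "{w. id x w \<noteq> 0} \<union> {w. ?a w \<noteq> 0} = insert u {w. x w \<noteq> 0}"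
      by auto
    ultimately show "{w. id x w \<noteq> 0} \<union> {w. ?a w \<noteq> 0} \<in> K"
      by (simp only:)
  qed (use down in auto)
  then show ?thesis
    unfolding contractible_space_def by blast
qed

section \<open>The boundary of the cross-polytope\<close>

text \<open>The complex is the join of the n + 1 two-point sets {p i, q i}. Taking p i and q i to
  the two unit vectors on the i-th axis identifies its realization with the l1 unit sphere in n + 1
  coordinates; rescaling between the l1 and the Euclidean norm gives the homeomorphism.\<close>

lemma cross_polytope_homeomorphic_nsphere:
  fixes p q :: "nat \<Rightarrow> 'a"
  assumes p: "inj_on p {..n}" and q: "inj_on q {..n}" and pq: "p ` {..n} \<inter> q ` {..n} = {}"
  shows "geometric_realization
           {S. S \<subseteq> p ` {..n} \<union> q ` {..n} \<and> (\<forall>i\<le>n. \<not> (p i \<in> S \<and> q i \<in> S))}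
         homeomorphic_space nsphere n"
proof -
  define V where "V = p ` {..n} \<union> q ` {..n}"
  define K where "K = {S. S \<subseteq> V \<and> (\<forall>i\<le>n. \<not> (p i \<in> S \<and> q i \<in> S))}"
  \<comment> \<open>Signed coordinates on the axes; the value 0 beyond \<open>n\<close> matches the
    points of \<open>nsphere n\<close>, which are sequences vanishing there.\<close>
  define d where "d x i = (if i \<le> n then x (p i) - x (q i) else 0)" for x :: "'a \<Rightarrow> real" and i
  define \<phi> where "\<phi> x i = d x i / sqrt (\<Sum>j\<le>n. (d x j)\<^sup>2)" for x i
  define s where "s y = (\<Sum>j\<le>n. \<bar>y j\<bar>)" for y :: "nat \<Rightarrow> real"
  \<comment> \<open>The inverse splits y into positive and negative parts and divides by the l1 norm
    \<open>s y\<close>. At a vertex only one summand survives, by injectivity and disjointness, and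
    none does outside \<open>V\<close>, so no inverses of \<open>p\<close> and \<open>q\<close> have
    to be chosen.\<close>
  define \<psi> where "\<psi> y v = (\<Sum>j\<le>n. (if v = p j then max 0 (y j) else 0) +
      (if v = q j then max 0 (- y j) else 0)) / s y" for y v
  have V: "finite V" "\<Union>K \<subseteq> V"
    by (auto simp: V_def K_def)
  note real = geometric_realization_finite[OF V]
  have sumV: "sum x V = (\<Sum>i\<le>n. x (p i) + x (q i))" for x :: "'a \<Rightarrow> real"
    unfolding V_def using pq by (simp add: sum.union_disjoint sum.reindex p q sum.distrib)
  have neq: "p i \<noteq> q j" "q j \<noteq> p i" if "i \<le> n" "j \<le> n" for i j
    using pq that by auto
  have \<psi>_p: "\<psi> y (p i) = max 0 (y i) / s y" if "i \<le> n" for y i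
  proof -
    have "(\<Sum>j\<le>n. (if p i = p j then max 0 (y j) else 0) + (if p i = q j then max 0 (- y j) else 0))
        = (\<Sum>j\<le>n. if j = i then max 0 (y j) else 0)"
      using that neq p by (intro sum.cong) (auto simp: inj_on_def)
    with that show ?thesis by (simp add: \<psi>_def)
  qed
  have \<psi>_q: "\<psi> y (q i) = max 0 (- y i) / s y" if "i \<le> n" for y i
  proof -
    have "(\<Sum>j\<le>n. (if q i = p j then max 0 (y j) else 0) + (if q i = q j then max 0 (- y j) else 0))
        = (\<Sum>j\<le>n. if j = i then max 0 (- y j) else 0)"
      using that neq q by (intro sum.cong) (auto simp: inj_on_def)
    with that show ?thesis by (simp add: \<psi>_def)
  qed
  have \<psi>_out: "\<psi> y v = 0" if "v \<notin> V" for y v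
    using that unfolding \<psi>_def V_def by (auto intro!: sum.neutral)
  have K: "(\<forall>v. 0 \<le> x v)" "x (p i) = 0 \<or> x (q i) = 0" "v \<notin> V \<Longrightarrow> x v = 0" "s (d x) = 1"
    if x: "x \<in> topspace (geometric_realization K)" and i: "i \<le> n" for x i v
  proof -
    show nonneg: "\<forall>v. 0 \<le> x v" and "v \<notin> V \<Longrightarrow> x v = 0"
      using x unfolding real by (auto simp: K_def)
    have zero: "x (p i) = 0 \<or> x (q i) = 0" if "i \<le> n" for i
      using x that unfolding real by (auto simp: K_def)
    then show "x (p i) = 0 \<or> x (q i) = 0"
      using i .
    \<comment> \<open>One of the weights at \<open>p j\<close> and \<open>q j\<close> is zero, so
      the absolute value of their difference is their sum.\<close>
    have "s (d x) = sum x V"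
      unfolding s_def sumV
    proof (intro sum.cong refl)
      fix j assume "j \<in> {..n}"
      then show "\<bar>d x j\<bar> = x (p j) + x (q j)"
        using zero[of j] nonneg by (auto simp: d_def)
    qed
    then show "s (d x) = 1"
      using x by (simp add: real)
  qed
  \<comment> \<open>This fact and \<open>s_pos\<close> keep the denominators of \<phi> and \<psi>
    away from zero: the l1 and Euclidean norms vanish only together.\<close>
  have pos: "(\<Sum>j\<le>n. (y j)\<^sup>2) > 0" if "s y \<noteq> 0" for y
  proof (rule ccontr)
    assume "\<not> (\<Sum>j\<le>n. (y j)\<^sup>2) > 0"
    then have "(\<Sum>j\<le>n. (y j)\<^sup>2) = 0"
      using sum_nonneg[of "{..n}" "\<lambda>j. (y j)\<^sup>2"] by simp
    then have "\<forall>j\<in>{..n}. y j = 0"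
      by (simp add: sum_nonneg_eq_0_iff)
    then show False
      using that by (simp add: s_def)
  qed
  have s_pos: "s y > 0" if "(\<Sum>j\<le>n. (y j)\<^sup>2) = 1" for y
  proof (rule ccontr)
    assume "\<not> s y > 0"
    then have "s y = 0"
      unfolding s_def using sum_nonneg[of "{..n}" "\<lambda>j. \<bar>y j\<bar>"] by linarith
    then have "\<forall>j\<in>{..n}. y j = 0"
      by (simp add: s_def sum_nonneg_eq_0_iff)
    then show False
      using that by simp
  qed
  have "homeomorphic_maps (geometric_realization K) (nsphere n) \<phi> \<psi>"
    unfolding homeomorphic_maps_def
  proof (intro conjI ballI)
    have d: "continuous_map (geometric_realization K) euclideanreal (\<lambda>x. d x i)" for i
      unfolding d_def
      by (cases "i \<le> n"; simp add: continuous_map_diff continuous_map_geometric_realization_coord)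
    have "continuous_map (geometric_realization K) (powertop_real UNIV) \<phi>"
      unfolding continuous_map_componentwise_UNIV \<phi>_def
    proof (intro allI continuous_intros d)
      fix x assume "x \<in> topspace (geometric_realization K)"
      then have "s (d x) = 1" using K(4) by blast
      then show "sqrt (\<Sum>j\<le>n. (d x j)\<^sup>2) \<noteq> 0" using pos[of "d x"] by simp
    qed auto
    moreover have "(\<Sum>i\<le>n. (\<phi> x i)\<^sup>2) = 1" if "x \<in> topspace (geometric_realization K)" for x
    proof -
      have "s (d x) = 1" using K(4) that by blast
      then have "(\<Sum>j\<le>n. (d x j)\<^sup>2) > 0" using pos[of "d x"] by simp
      then show ?thesis
        by (simp add: \<phi>_def power_divide sum_nonneg flip: sum_divide_distrib)
    qed
    ultimately show "continuous_map (geometric_realization K) (nsphere n) \<phi>"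
      unfolding nsphere by (intro continuous_map_into_subtopology) (auto simp: \<phi>_def d_def)
  next
    have "continuous_map (nsphere n) (powertop_real UNIV) \<psi>"
      unfolding continuous_map_componentwise_UNIV
    proof
      fix v
      have c: "continuous_map (nsphere n) euclideanreal
          (\<lambda>y. (if v = p j then max 0 (y j) else 0) + (if v = q j then max 0 (- y j) else 0))" for j
        by (cases "v = p j"; cases "v = q j"; simp; intro continuous_intros continuous_map_nsphere_projection)
      show "continuous_map (nsphere n) euclideanreal (\<lambda>y. \<psi> y v)"
        unfolding \<psi>_def s_def
      proof (intro continuous_intros c continuous_map_nsphere_projection)
        fix y assume "y \<in> topspace (nsphere n)"
        then show "(\<Sum>j\<le>n. \<bar>y j\<bar>) \<noteq> 0"
          using s_pos[of y] by (auto simp: nsphere s_def)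
      qed auto
    qed
    moreover have "\<psi> y \<in> {x. (\<forall>v. 0 \<le> x v) \<and> {v. x v \<noteq> 0} \<in> K \<and> sum x V = 1}"
      if "y \<in> topspace (nsphere n)" for y
    proof -
      have s: "s y > 0"
        using that s_pos by (auto simp: nsphere)
      have "0 \<le> \<psi> y v" for v
        unfolding \<psi>_def using s by (intro divide_nonneg_pos sum_nonneg) auto
      moreover have "{v. \<psi> y v \<noteq> 0} \<in> K"
        using \<psi>_out by (auto simp: K_def \<psi>_p \<psi>_q max_def split: if_splits)
      moreover have "sum (\<psi> y) V = (\<Sum>i\<le>n. \<bar>y i\<bar> / s y)"
        unfolding sumV
      proof (intro sum.cong refl)
        fix i assume "i \<in> {..n}"
        then show "\<psi> y (p i) + \<psi> y (q i) = \<bar>y i\<bar> / s y"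
          by (auto simp: \<psi>_p \<psi>_q max_def)
      qed
      then have "sum (\<psi> y) V = 1"
        using s by (simp add: s_def flip: sum_divide_distrib)
      ultimately show ?thesis by simp
    qed
    ultimately show "continuous_map (nsphere n) (geometric_realization K) \<psi>"
      unfolding real by (intro continuous_map_into_subtopology) auto
  next
    fix x assume x: "x \<in> topspace (geometric_realization K)"
    define c where "c = sqrt (\<Sum>j\<le>n. (d x j)\<^sup>2)"
    have sd: "s (d x) = 1" using K(4)[OF x] by blast
    then have c: "c > 0" using pos[of "d x"] by (simp add: c_def)
    have \<phi>: "\<phi> x i = d x i / c" for i
      by (simp add: \<phi>_def c_def)
    \<comment> \<open>By homogeneity, dividing by the l1 norm of \<phi> x multiplies by
      \<open>c\<close> again and so recovers \<open>d x\<close>.\<close>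
    have "s (\<phi> x) = s (d x) / c"
      using c by (simp add: s_def \<phi> sum_divide_distrib)
    then have s\<phi>: "s (\<phi> x) = 1 / c"
      using sd by simp
    show "\<psi> (\<phi> x) = x"
    proof
      fix v
      consider i where "i \<le> n" "v = p i" | i where "i \<le> n" "v = q i" | "v \<notin> V"
        unfolding V_def by auto
      then show "\<psi> (\<phi> x) v = x v"
      proof cases
        case 1
        then show ?thesis
          using K(1,2)[OF x \<open>i \<le> n\<close>] c
          by (auto simp: \<psi>_p s\<phi> \<phi> d_def max_def field_simps intro: order_antisym)
      next
        case 2
        then show ?thesis
          using K(1,2)[OF x \<open>i \<le> n\<close>] c
          by (auto simp: \<psi>_q s\<phi> \<phi> d_def max_def field_simps intro: order_antisym)
      next
        case 3
        then show ?thesis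
          using K(3)[OF x] \<psi>_out by auto
      qed
    qed
  next
    fix y assume y: "y \<in> topspace (nsphere n)"
    then have y1: "(\<Sum>j\<le>n. (y j)\<^sup>2) = 1" and y0: "\<And>i. i > n \<Longrightarrow> y i = 0"
      by (auto simp: nsphere)
    have s: "s y > 0"
      using y1 s_pos by simp
    \<comment> \<open>The positive and negative parts recombine. The Euclidean norm of the result is
      1 / s y, so normalizing returns y.\<close>
    have d: "d (\<psi> y) i = y i / s y" for i
      using y0[of i] by (auto simp: d_def \<psi>_p \<psi>_q max_def)
    show "\<phi> (\<psi> y) = y"
    proof
      fix i
      show "\<phi> (\<psi> y) i = y i"
        using s by (simp add: \<phi>_def d power_divide y1 real_sqrt_divide flip: sum_divide_distrib)
    qed
  qed
  then show ?thesis
    unfolding homeomorphic_space_def K_def V_def by blast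
qed

section \<open>The complexes of the graphs \<open>\<Delta>\<close>\<close>

text \<open>The vertices of index 2, 4, ..., 2k are removed by restricting the complex, not by
  building a smaller graph. Conditions on indices outside the graph hold vacuously, so
  \<open>k\<close> and \<open>N\<close> can vary independently.\<close>

definition folded_Delta :: "nat \<Rightarrow> nat \<Rightarrow> Delta_vertex set set" where
  "folded_Delta N k = {S \<in> independence_complex (Delta_verts 1 N) (Delta_edges 1 N).
     \<forall>j. 1 \<le> j \<and> j \<le> k \<longrightarrow> Ev (2 * j) \<notin> S \<and> Fv 1 (2 * j) \<notin> S}"

text \<open>Every edge has an end of the form \<open>Fv 1 i\<close>, so independence can be tested
  from there. The index bounds of the edges are absorbed by \<open>S\<close> being a set of
  vertices.\<close>

lemma independence_complex_Delta_1:
  "S \<in> independence_complex (Delta_verts 1 N) (Delta_edges 1 N) \<longleftrightarrow>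
     S \<subseteq> Delta_verts 1 N \<and>
     (\<forall>i. Fv 1 i \<in> S \<longrightarrow> Ev i \<notin> S \<and> Ev (i + 1) \<notin> S \<and> Fv 1 (i + 1) \<notin> S)"
  (is "_ \<longleftrightarrow> ?R")
proof
  assume S: "S \<in> independence_complex (Delta_verts 1 N) (Delta_edges 1 N)"
  then have V: "S \<subseteq> Delta_verts 1 N" and E: "\<And>u v. u \<in> S \<Longrightarrow> v \<in> S \<Longrightarrow> {u, v} \<notin> Delta_edges 1 N"
    by (auto simp: independence_complex_def)
  have "Ev i \<notin> S \<and> Ev (i + 1) \<notin> S \<and> Fv 1 (i + 1) \<notin> S" if "Fv 1 i \<in> S" for i
  proof -
    have i: "1 \<le> i" "i \<le> N - 1"
      using V that by (auto simp: Delta_verts_def)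
    have "{Ev i, Fv 1 i} \<in> Delta_edges 1 N" "{Fv 1 i, Ev (i + 1)} \<in> Delta_edges 1 N"
      using i unfolding Delta_edges_def by blast+
    moreover have "{Fv 1 i, Fv 1 (i + 1)} \<in> Delta_edges 1 N" if "Fv 1 (i + 1) \<in> S"
    proof -
      have "i \<le> N - 2"
        using V that by (auto simp: Delta_verts_def)
      with i show ?thesis unfolding Delta_edges_def by blast
    qed
    ultimately show ?thesis
      using E that by blast
  qed
  with V show ?R by blast
next
  assume R: ?R
  then have "{u, v} \<notin> Delta_edges 1 N" if "u \<in> S" "v \<in> S" for u v
    using that unfolding Delta_edges_def by (auto simp: doubleton_eq_iff)
  with R show "S \<in> independence_complex (Delta_verts 1 N) (Delta_edges 1 N)"
    using finite_subset[OF _ finite_Delta_verts] by (auto simp: independence_complex_def)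
qed

lemma folded_Delta_0:
  "folded_Delta N 0 = independence_complex (Delta_verts 1 N) (Delta_edges 1 N)"
  by (auto simp: folded_Delta_def)

lemma Union_folded_Delta: "\<Union>(folded_Delta N k) \<subseteq> Delta_verts 1 N"
  by (auto simp: folded_Delta_def independence_complex_def)

lemma folded_Delta_down: "S \<in> folded_Delta N k \<Longrightarrow> T \<subseteq> S \<Longrightarrow> T \<in> folded_Delta N k"
  unfolding folded_Delta_def independence_complex_Delta_1 by blast

text \<open>This is the domination condition for both removals of round k + 1. Since f_{2k} is
  already gone, f_{2k+1} is the only possible neighbour of e_{2k+1} left; it is adjacent to e_{2k+2}
  and to f_{2k+2}, so either of these in \<open>S\<close> excludes it.\<close>

lemma insert_folded_Delta:
  assumes S: "S \<in> folded_Delta N k" and v: "Ev (2 * k + 2) \<in> S \<or> Fv 1 (2 * k + 2) \<in> S"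
  shows "insert (Ev (2 * k + 1)) S \<in> folded_Delta N k"
proof -
  have S': "S \<subseteq> Delta_verts 1 N"
    "\<And>i. Fv 1 i \<in> S \<Longrightarrow> Ev i \<notin> S \<and> Ev (i + 1) \<notin> S \<and> Fv 1 (i + 1) \<notin> S"
    "\<And>j. 1 \<le> j \<Longrightarrow> j \<le> k \<Longrightarrow> Ev (2 * j) \<notin> S \<and> Fv 1 (2 * j) \<notin> S"
    using S by (auto simp: folded_Delta_def independence_complex_Delta_1 simp del: One_nat_def)
  have "Ev (2 * k + 1) \<in> Delta_verts 1 N"
    using S' v by (auto simp: Delta_verts_def)
  moreover have "Fv 1 (2 * k + 1) \<notin> S"
    using S'(2)[of "2 * k + 1"] v by auto
  \<comment> \<open>For k = 0 this holds because indices start at 1, otherwise because round k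
    removed the vertex.\<close>
  moreover have "Fv 1 (2 * k) \<notin> S"
    using S'(1) S'(3)[of k] by (cases "k = 0") (auto simp: Delta_verts_def)
  ultimately show ?thesis
    using S' by (auto simp: folded_Delta_def independence_complex_Delta_1 simp del: One_nat_def)
qed

text \<open>Both folds push onto e_{2k+1}. The second takes place in the smaller complex
  \<open>?L\<close>, where domination persists because inserting e_{2k+1} does not bring back
  e_{2k+2}. If 2k + 2 exceeds \<open>N\<close>, both folds are trivial.\<close>

lemma folded_Delta_Suc:
  "geometric_realization (folded_Delta N k) homotopy_equivalent_space
   geometric_realization (folded_Delta N (Suc k))"
proof -
  let ?L = "{S \<in> folded_Delta N k. Ev (2 * k + 2) \<notin> S}"
  have "geometric_realization (folded_Delta N k) homotopy_equivalent_space geometric_realization ?L"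
    by (rule fold_homotopy_equivalent_space[where u = "Ev (2 * k + 1)",
          OF finite_Delta_verts Union_folded_Delta])
       (use folded_Delta_down insert_folded_Delta in \<open>auto simp del: One_nat_def add_2_eq_Suc'\<close>)
  also have "geometric_realization ?L homotopy_equivalent_space
      geometric_realization {S \<in> ?L. Fv 1 (2 * k + 2) \<notin> S}"
  proof (rule fold_homotopy_equivalent_space[where u = "Ev (2 * k + 1)", OF finite_Delta_verts])
    show "\<Union>?L \<subseteq> Delta_verts 1 N"
      using Union_folded_Delta by blast
    show "T \<in> ?L" if "S \<in> ?L" "T \<subseteq> S" for S T
      using that folded_Delta_down by blast
  qed (use insert_folded_Delta in \<open>auto simp del: One_nat_def add_2_eq_Suc'\<close>)
  also have "{S \<in> ?L. Fv 1 (2 * k + 2) \<notin> S} = folded_Delta N (Suc k)"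
    by (auto simp: folded_Delta_def le_Suc_eq)
  finally show ?thesis .
qed

lemma I_Delta_homotopy_equivalent_folded:
  "I_Delta 1 N homotopy_equivalent_space geometric_realization (folded_Delta N k)"
proof (induction k)
  case 0
  then show ?case
    by (simp add: I_Delta_def folded_Delta_0 homotopy_equivalent_space_refl)
next
  case (Suc k)
  then show ?case
    using folded_Delta_Suc homotopy_eqv_trans by blast
qed

text \<open>The f-vertices stop at index 2n, and f_{2n} is removed in round n, so e_{2n+1} has no
  neighbour left and serves as apex. For n = 0 it is the only vertex.\<close>

lemma contractible_space_I_Delta_odd: "contractible_space (I_Delta 1 (2 * n + 1))"
proof -
  let ?K = "folded_Delta (2 * n + 1) n"
  have "contractible_space (geometric_realization ?K)"
  proof (rule contractible_space_cone[OF finite_Delta_verts Union_folded_Delta])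
    show "{} \<in> ?K"
      by (simp add: folded_Delta_def independence_complex_Delta_1 del: One_nat_def)
    show "insert (Ev (2 * n + 1)) S \<in> ?K" if S: "S \<in> ?K" for S
    proof -
      have S': "S \<subseteq> Delta_verts 1 (2 * n + 1)" "1 \<le> n \<Longrightarrow> Fv 1 (2 * n) \<notin> S"
        using S by (auto simp: folded_Delta_def independence_complex_Delta_1 simp del: One_nat_def)
      then have "Fv 1 (2 * n + 1) \<notin> S" "Fv 1 (2 * n) \<notin> S"
        by (auto simp: Delta_verts_def)
      moreover have "Ev (2 * n + 1) \<in> Delta_verts 1 (2 * n + 1)"
        by (simp add: Delta_verts_def)
      ultimately show ?thesis
        using S by (auto simp: folded_Delta_def independence_complex_Delta_1 simp del: One_nat_def)
    qed
  qed (rule folded_Delta_down)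
  then show ?thesis
    using I_Delta_homotopy_equivalent_folded homotopy_equivalent_space_contractibility by blast
qed

text \<open>Exactly the odd indices 2i + 1 with i from 0 to n survive. Edges between consecutive
  indices lose an end by parity, which leaves the n + 1 disjoint edges from \<open>p i\<close> to
  \<open>q i\<close>.\<close>

lemma folded_Delta_eq_cross_polytope:
  fixes n :: nat
  defines "p \<equiv> \<lambda>i. Ev (2 * i + 1)" and "q \<equiv> \<lambda>i. Fv 1 (2 * i + 1)"
  shows "folded_Delta (2 * n + 2) (n + 1) =
    {S. S \<subseteq> p ` {..n} \<union> q ` {..n} \<and> (\<forall>i\<le>n. \<not> (p i \<in> S \<and> q i \<in> S))}"
    (is "_ = ?C")
proof (intro equalityI subsetI)
  fix S assume "S \<in> folded_Delta (2 * n + 2) (n + 1)"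
  then have S: "S \<subseteq> Delta_verts 1 (2 * n + 2)"
    "\<And>i. Fv 1 i \<in> S \<Longrightarrow> Ev i \<notin> S"
    "\<And>j. 1 \<le> j \<Longrightarrow> j \<le> n + 1 \<Longrightarrow> Ev (2 * j) \<notin> S \<and> Fv 1 (2 * j) \<notin> S"
    by (auto simp: folded_Delta_def independence_complex_Delta_1 simp del: One_nat_def)
  have "v \<in> p ` {..n} \<union> q ` {..n}" if v: "v \<in> S" for v
  proof -
    obtain i where i: "v = Ev i \<or> v = Fv 1 i" "1 \<le> i" "i \<le> 2 * n + 2"
      using S(1) v by (auto simp: Delta_verts_def)
    have "odd i"
    proof
      assume "even i"
      then obtain j where "i = 2 * j" by blast
      then show False
        using S(3)[of j] i v by auto
    qed
    then obtain j where "i = 2 * j + 1" by (rule oddE)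
    then show ?thesis
      using i by (auto simp: p_def q_def)
  qed
  moreover have "\<not> (p i \<in> S \<and> q i \<in> S)" for i
    using S(2) by (auto simp: p_def q_def)
  ultimately show "S \<in> ?C"
    by blast
next
  fix S assume S: "S \<in> ?C"
  have E: "\<exists>j\<le>n. i = 2 * j + 1" if "Ev i \<in> S" for i
    using S that by (auto simp: p_def q_def)
  have F: "k = 1 \<and> (\<exists>j\<le>n. i = 2 * j + 1)" if "Fv k i \<in> S" for i k
    using S that by (auto simp: p_def q_def)
  have "S \<subseteq> Delta_verts 1 (2 * n + 2)"
    using S by (auto simp: p_def q_def Delta_verts_def)
  moreover have "Ev i \<notin> S \<and> Ev (i + 1) \<notin> S \<and> Fv 1 (i + 1) \<notin> S" if "Fv 1 i \<in> S" for i
  proof -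
    obtain j where j: "j \<le> n" "i = 2 * j + 1"
      using F[OF \<open>Fv 1 i \<in> S\<close>] by blast
    then have "Ev i \<notin> S"
      using S that by (auto simp: p_def q_def)
    \<comment> \<open>The successor of an odd index is even, so no vertex of \<open>S\<close>
      carries it.\<close>
    moreover have "i + 1 \<noteq> 2 * j' + 1" for j'
      using j by presburger
    ultimately show ?thesis
      using E F by blast
  qed
  moreover have "Ev (2 * j) \<notin> S \<and> Fv 1 (2 * j) \<notin> S" for j
  proof -
    have "2 * j \<noteq> 2 * j' + 1" for j' :: nat by presburger
    then show ?thesis using E F by blast
  qed
  ultimately show "S \<in> folded_Delta (2 * n + 2) (n + 1)"
    by (auto simp: folded_Delta_def independence_complex_Delta_1 simp del: One_nat_def)
qed

lemma I_Delta_even_homotopy_equivalent_nsphere: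
  "I_Delta 1 (2 * n + 2) homotopy_equivalent_space nsphere n"
proof -
  have "geometric_realization (folded_Delta (2 * n + 2) (n + 1)) homeomorphic_space nsphere n"
    unfolding folded_Delta_eq_cross_polytope
    by (rule cross_polytope_homeomorphic_nsphere) (auto simp: inj_on_def)
  then show ?thesis
    using I_Delta_homotopy_equivalent_folded homeomorphic_imp_homotopy_equivalent_space
      homotopy_eqv_trans by blast
qed

theorem theorem1p1:
  fixes n :: nat
  assumes "n \<ge> 1"
  shows "I_Delta 1 (2 * n) homotopy_equivalent_space nsphere (n - 1) \<and>
         contractible_space (I_Delta 1 (2 * n - 1))"
proof -
  \<comment> \<open>The shift turns 2n, n - 1 and 2n - 1 into 2k + 2, k and 2k + 1, free of
    truncated subtraction.\<close>
  obtain k where "n = k + 1"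
    using assms by (metis add.commute le_Suc_ex)
  then show ?thesis
    using I_Delta_even_homotopy_equivalent_nsphere[of k] contractible_space_I_Delta_odd[of k]
    by simp
qed

end
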